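(* Let $0<p<\infty$ and let $M$ be an Orlicz function such that $t\mapsto M(t^{1/p})$ is also an Orlicz function. Let $\lambda=\{\lambda_k\}_{k=1}^\infty$ be an arbitrary non-increasing sequence of positive numbers with $\lim_{k\to\infty}\lambda_k=0$, and let $T$ be the diagonal operator $T\{x_k\}_{k=1}^\infty=\{\lambda_kx_k\}_{k=1}^\infty$. Then for every $n\in\mathbb N$, $$\sigma_n(T:l_p\to l_M)=\sup_{s>n}\frac{\Big(\sum_{k=1}^s\lambda_k^{-p}\Big)^{-1/p}}{M^{-1}\big(\frac1{s-n}\big)},$$ where the supremum is over integers $s>n$ and $M^{-1}$ is the inverse function of $M$. The supremum on the right-hand side is attained at some finite value $s^*$ of $s$. The supremum over $x\in B\,l_p$ in the definition $\sigma_n(T:l_p\to l_M)=\sup_{x\in B\,l_p}\sigma_n(Tx,l_M)$ is realized by the sequence $x^*=\{x_k^*\}_{k=1}^\infty$ given by $$x_k^*=\begin{cases}\Big(\lambda_k^p\sum_{j=1}^{s^*}\lambda_j^{-p}\Big)^{-1/p}, & k=1,2,\dots,s^*,\\ 0,& k>s^*.\end{cases}$$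
   Context: An Orlicz function is a non-decreasing convex function $M:[0,\infty)\to[0,\infty)$ with $M(0)=0$ and $M(t)\to\infty$ as $t\to\infty$. The Orlicz sequence space $l_M$ is the Banach space of all real sequences $x=\{x_k\}_{k=1}^\infty$ with finite norm $$\|x\|_{l_M}:=\inf\Big\{\alpha>0:\ \sum_{k=1}^\infty M(|x_k|/\alpha)\le 1\Big\}.$$ For $0<p<\infty$, $l_p$ is the space of real sequences with $\|x\|_{l_p}:=\big(\sum_{k=1}^\infty|x_k|^p\big)^{1/p}<\infty$, and $B\,l_p=\{x\in l_p:\|x\|_{l_p}\le1\}$. $e_i$ denotes the sequence whose $i$-th entry is $1$ and whose other entries are $0$. The best $n$-term approximation of $x\in l_M$ is $$\sigma_n(x,l_M):=\inf_{\gamma_n}\ \inf_{a_i\in\mathbb R,\ i\in\gamma_n}\Big\|x-\sum_{i\in\gamma_n}a_ie_i\Big\|_{l_M},$$ where $\gamma_n$ ranges over all sets of $n$ distinct positive integers, and $$\sigma_n(T:l_p\to l_M):=\sup_{x\in B\,l_p}\sigma_n(Tx,l_M).$$ *)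

theory Defs
  imports "HOL-Analysis.Analysis"
begin

text \<open>
  A sequence \<open>{x\<^sub>k}\<close> indexed by the positive integers is a function \<open>x :: nat \<Rightarrow> real\<close> whose value
  \<open>x k\<close> is the entry number \<open>k + 1\<close>; so \<open>\<Sum>k<s\<close> ranges over the first \<open>s\<close> entries.
\<close>

text \<open>An Orlicz function is defined on \<open>[0, \<infinity>)\<close>; its values at negative arguments play no role.\<close>

definition orlicz_function :: "(real \<Rightarrow> real) \<Rightarrow> bool" where
  "orlicz_function M \<longleftrightarrow>
     (\<forall>t\<ge>0. 0 \<le> M t) \<and> mono_on {0..} M \<and> convex_on {0..} M \<and> M 0 = 0 \<and> filterlim M at_top at_top"

text \<open>
  The Luxemburg norm is extended-valued: it is \<open>\<infinity>\<close> exactly for the sequences outside \<open>l\<^sub>M\<close>.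
\<close>

definition orlicz_norm :: "(real \<Rightarrow> real) \<Rightarrow> (nat \<Rightarrow> real) \<Rightarrow> ennreal" where
  "orlicz_norm M x =
     (INF \<alpha>\<in>{\<alpha>. 0 < \<alpha> \<and> (\<Sum>k. ennreal (M (\<bar>x k\<bar> / \<alpha>))) \<le> 1}. ennreal \<alpha>)"

definition lp_space :: "real \<Rightarrow> (nat \<Rightarrow> real) set" where
  "lp_space p = {x. summable (\<lambda>k. \<bar>x k\<bar> powr p)}"

definition lp_norm :: "real \<Rightarrow> (nat \<Rightarrow> real) \<Rightarrow> real" where
  "lp_norm p x = (\<Sum>k. \<bar>x k\<bar> powr p) powr (1 / p)"

definition lp_ball :: "real \<Rightarrow> (nat \<Rightarrow> real) set" where
  "lp_ball p = {x \<in> lp_space p. lp_norm p x \<le> 1}"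

definition unit_seq :: "nat \<Rightarrow> nat \<Rightarrow> real" where
  "unit_seq i = (\<lambda>k. if k = i then 1 else 0)"

text \<open>The coefficients \<open>a i\<close> with \<open>i \<notin> \<gamma>\<close> do not enter the norm.\<close>

definition best_approx :: "nat \<Rightarrow> (real \<Rightarrow> real) \<Rightarrow> (nat \<Rightarrow> real) \<Rightarrow> ennreal" where
  "best_approx n M x =
     (INF \<gamma>\<in>{\<gamma>. finite \<gamma> \<and> card \<gamma> = n}. INF a::nat \<Rightarrow> real.
        orlicz_norm M (\<lambda>k. x k - (\<Sum>i\<in>\<gamma>. a i * unit_seq i k)))"

definition best_approx_op ::
    "nat \<Rightarrow> real \<Rightarrow> (real \<Rightarrow> real) \<Rightarrow> ((nat \<Rightarrow> real) \<Rightarrow> nat \<Rightarrow> real) \<Rightarrow> ennreal" where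
  "best_approx_op n p M T = (SUP x\<in>lp_ball p. best_approx n M (T x))"

definition diag_op :: "(nat \<Rightarrow> real) \<Rightarrow> (nat \<Rightarrow> real) \<Rightarrow> nat \<Rightarrow> real" where
  "diag_op lam x = (\<lambda>k. lam k * x k)"

text \<open>
  An Orlicz function may vanish on an initial interval, but it takes each positive value at exactly
  one point of \<open>[0, \<infinity>)\<close>, so its inverse is unambiguous at the arguments \<open>1 / (s - n)\<close> with \<open>n < s\<close>.
\<close>

definition diag_quotient ::
    "nat \<Rightarrow> real \<Rightarrow> (real \<Rightarrow> real) \<Rightarrow> (nat \<Rightarrow> real) \<Rightarrow> nat \<Rightarrow> real" where
  "diag_quotient n p M lam s =
     (\<Sum>k<s. lam k powr (- p)) powr (- (1 / p)) / inv_into {0..} M (1 / (real s - real n))"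

definition extremal_seq :: "real \<Rightarrow> (nat \<Rightarrow> real) \<Rightarrow> nat \<Rightarrow> nat \<Rightarrow> real" where
  "extremal_seq p lam s =
     (\<lambda>k. if k < s then (lam k powr p * (\<Sum>j<s. lam j powr (- p))) powr (- (1 / p)) else 0)"

end

theory Submission imports Defs begin

text \<open>
  Put \<open>N t = M (t powr (1 / p))\<close>, \<open>\<mu> k = lam k powr (- p)\<close> and \<open>z k = \<bar>lam k * x k\<bar> powr p\<close>. For \<open>x\<close>
  in the ball, \<open>z\<close> is a nonnegative sequence with \<open>\<Sum>k. \<mu> k * z k \<le> 1\<close>, and after removal of the \<open>n\<close>
  largest entries of \<open>z\<close> one has to bound \<open>\<Sum>k. N (c * z k)\<close>. Subtracting the smallest entry over
  and over writes \<open>z\<close> as a convex combination of normalised indicators of nested sets \<open>U\<close>. The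
  function \<open>N\<close> is convex, so it suffices to treat these indicators, and since \<open>\<mu>\<close> is increasing the
  worst \<open>U\<close> of cardinality \<open>s\<close> is the initial segment. This is the upper bound. The same
  indicators, pulled back through the operator, are the extremal sequences and give the lower bound.
  The supremum over \<open>s\<close> is attained because the averages of \<open>\<mu>\<close> tend to infinity, which makes the
  quotients tend to 0.
\<close>

section \<open>Monotone sums and selection of largest entries\<close>

text \<open>Removing \<open>Max A\<close> drives the induction: \<open>A\<close> lies in
  \<open>{..Max A}\<close>, so \<open>Max A\<close> is at least \<open>card A - 1\<close>, and the
  term \<open>f m\<close> lost on the left is at most \<open>f (Max A)\<close>.\<close>

lemma sum_lessThan_card_le:
  fixes f :: "nat \<Rightarrow> real"
  assumes "mono f" "finite A"
  shows "(\<Sum>k<card A. f k) \<le> sum f A"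
  using \<open>finite A\<close>
proof (induction "card A" arbitrary: A)
  case 0
  then show ?case by simp
next
  case (Suc m)
  then have ne: "A \<noteq> {}" by auto
  have cm: "card (A - {Max A}) = m"
    using Suc ne by (simp add: card_Diff_singleton)
  have "A \<subseteq> {..Max A}" using Suc.prems by auto
  then have "card A \<le> Suc (Max A)"
    using card_mono[of "{..Max A}" A] by simp
  then have "f m \<le> f (Max A)"
    using Suc.hyps(2) by (intro monoD[OF \<open>mono f\<close>]) simp
  moreover have "(\<Sum>k<m. f k) \<le> sum f (A - {Max A})"
    using Suc.hyps(1)[of "A - {Max A}"] cm Suc.prems by simp
  moreover have "sum f A = f (Max A) + sum f (A - {Max A})"
    using Suc.prems ne by (simp add: sum.remove)
  moreover have "(\<Sum>k<card A. f k) = (\<Sum>k<m. f k) + f m"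
    by (simp flip: Suc.hyps(2))
  ultimately show ?case by linarith
qed

text \<open>Greedy choice: each step adds a largest entry outside \<open>\<gamma>\<close>. It exists
  because \<open>z\<close> tends to 0, so only finitely many entries reach a given positive value;
  when all remaining entries vanish, any new index serves.\<close>

lemma exists_largest_entries:
  fixes z :: "nat \<Rightarrow> real"
  assumes "z \<longlonglongrightarrow> 0" "\<And>k. 0 \<le> z k"
  shows "\<exists>\<gamma>. finite \<gamma> \<and> card \<gamma> = n \<and> (\<forall>i\<in>\<gamma>. \<forall>k. k \<notin> \<gamma> \<longrightarrow> z k \<le> z i)"
proof (induction n)
  case 0
  show ?case by (intro exI[of _ "{}"]) simp
next
  case (Suc n)
  then obtain \<gamma> where g: "finite \<gamma>" "card \<gamma> = n" "\<And>i k. i \<in> \<gamma> \<Longrightarrow> k \<notin> \<gamma> \<Longrightarrow> z k \<le> z i"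
    by blast
  have "\<exists>j. j \<notin> \<gamma> \<and> (\<forall>k. k \<notin> \<gamma> \<longrightarrow> z k \<le> z j)"
  proof (cases "\<forall>k. k \<notin> \<gamma> \<longrightarrow> z k = 0")
    case True
    with ex_new_if_finite[OF infinite_UNIV_nat g(1)] show ?thesis by auto
  next
    case False
    then obtain k0 where k0: "k0 \<notin> \<gamma>" "0 < z k0"
      using assms(2) by (metis less_eq_real_def)
    define S where "S = {k. k \<notin> \<gamma> \<and> z k0 \<le> z k}"
    have "eventually (\<lambda>k. z k < z k0) sequentially"
      using assms(1) k0(2) by (rule order_tendstoD)
    then obtain m where "\<And>k. m \<le> k \<Longrightarrow> z k < z k0"
      unfolding eventually_sequentially by blast
    then have "S \<subseteq> {..<m}"
      unfolding S_def by (metis (mono_tags, lifting) leD lessThan_iff linorder_not_less mem_Collect_eq subsetI)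
    then have fin: "finite (z ` S)" using finite_subset by blast
    have k0S: "k0 \<in> S" using k0 by (simp add: S_def)
    then have "Max (z ` S) \<in> z ` S" using fin by (intro Max_in) auto
    then obtain j where j: "j \<in> S" "z j = Max (z ` S)" by auto
    have "z k \<le> z j" if "k \<notin> \<gamma>" for k
    proof (cases "k \<in> S")
      case True
      then show ?thesis using fin j by simp
    next
      case False
      then show ?thesis using that j(1) by (auto simp: S_def)
    qed
    then show ?thesis using j(1) by (auto simp: S_def)
  qed
  then obtain j where j: "j \<notin> \<gamma>" "\<And>k. k \<notin> \<gamma> \<Longrightarrow> z k \<le> z j" by blast
  show ?case
    using g j by (intro exI[of _ "insert j \<gamma>"]) auto
qed

section \<open>Convex decomposition into nested indicators\<close>

text \<open>Induction on \<open>card A\<close> with \<open>z\<close> varying: the constant part of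
  \<open>z\<close> on \<open>A \<union> \<gamma>\<close> is split off, and the rescaled remainder
  vanishes at a point of \<open>A\<close>, which is dropped. \<open>\<gamma>\<close> stays whole, so
  the bound on \<open>N\<close> for initial segments can be used with the same
  \<open>card \<gamma>\<close> throughout.\<close>

lemma peeling_bound:
  fixes N :: "real \<Rightarrow> real" and \<mu> z :: "nat \<Rightarrow> real"
  assumes N: "convex_on {0..} N" "mono_on {0..} N" "N 0 = 0"
    and \<mu>: "\<And>k. 0 < \<mu> k" "mono \<mu>"
    and c: "0 \<le> c" "\<And>s. card \<gamma> < s \<Longrightarrow> (real s - real (card \<gamma>)) * N (c / (\<Sum>k<s. \<mu> k)) \<le> 1"
    and "finite \<gamma>" "finite A" "A \<inter> \<gamma> = {}" "\<And>k. 0 \<le> z k"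
    and "\<And>i k. i \<in> \<gamma> \<Longrightarrow> k \<in> A \<Longrightarrow> z k \<le> z i"
    and "(\<Sum>k\<in>A \<union> \<gamma>. \<mu> k * z k) \<le> 1"
  shows "(\<Sum>k\<in>A. N (c * z k)) \<le> 1"
  using assms(9-13)
proof (induction "card A" arbitrary: A z)
  case 0
  then show ?case by simp
next
  case (Suc m)
  note finA = Suc.prems(1) and disj = Suc.prems(2) and z0 = Suc.prems(3)
    and dom = Suc.prems(4) and total = Suc.prems(5)
  have "A \<noteq> {}" using Suc.hyps(2) by auto
  then have "Min (z ` A) \<in> z ` A" using finA by (intro Min_in) auto
  then obtain a where a: "a \<in> A" "z a = Min (z ` A)" by auto
  define t where "t = z a"
  define U where "U = A \<union> \<gamma>"
  define L where "L = sum \<mu> U"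
  \<comment> \<open>The minimum over \<open>A\<close> is a minimum over all of \<open>U\<close>,
    since the entries on \<open>\<gamma>\<close> dominate \<open>z a\<close>.\<close>
  have tA: "t \<le> z k" if "k \<in> U" for k
    using that a finA dom[of k a] by (auto simp: U_def t_def)
  have finU: "finite U" using finA assms(8) by (simp add: U_def)
  have Lpos: "0 < L"
    unfolding L_def using a(1) \<mu>(1) finU by (intro sum_pos) (auto simp: U_def)
  have cardU: "card U = card A + card \<gamma>"
    unfolding U_def using finA assms(8) disj by (rule card_Un_disjoint)
  \<comment> \<open>\<open>1 / L\<close> is the height at which the indicator of \<open>U\<close>
    has \<open>\<mu>\<close>-mass 1. As \<open>card A = card U - card \<gamma>\<close>, comparing
    \<open>U\<close> with an initial segment reduces the claim to the hypothesis on
    \<open>N\<close>.\<close>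
  have flat: "(\<Sum>k\<in>A. N (c / L)) \<le> 1"
  proof -
    have "(\<Sum>k<card U. \<mu> k) \<le> L"
      unfolding L_def using \<mu>(2) finU by (rule sum_lessThan_card_le)
    moreover have "0 < (\<Sum>k<card U. \<mu> k)"
      using cardU Suc.hyps(2) \<mu>(1) by (intro sum_pos) (auto simp: lessThan_empty_iff)
    ultimately have "N (c / L) \<le> N (c / (\<Sum>k<card U. \<mu> k))"
      using c(1) Lpos by (intro mono_onD[OF N(2)] divide_left_mono) auto
    then have "real (card A) * N (c / L) \<le> real (card A) * N (c / (\<Sum>k<card U. \<mu> k))"
      by (rule mult_left_mono) simp
    also have "\<dots> \<le> 1"
      using c(2)[of "card U"] cardU Suc.hyps(2) by simp
    finally show ?thesis by simp
  qed
  \<comment> \<open>\<open>w\<close> is the \<open>\<mu>\<close>-mass of the constant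
    \<open>t\<close> on \<open>U\<close>; it becomes the weight of the normalised indicator.\<close>
  define w where "w = t * L"
  have t0: "0 \<le> t" using z0 by (simp add: t_def)
  have w0: "0 \<le> w" using t0 Lpos by (simp add: w_def)
  have split: "(\<Sum>k\<in>U. \<mu> k * z k) = w + (\<Sum>k\<in>U. \<mu> k * (z k - t))"
    unfolding w_def L_def by (simp add: algebra_simps sum_subtractf sum_distrib_left)
  have rest0: "0 \<le> (\<Sum>k\<in>U. \<mu> k * (z k - t))"
    using tA \<mu>(1) by (intro sum_nonneg mult_nonneg_nonneg) (auto simp: less_imp_le)
  have w1: "w \<le> 1" using split rest0 total unfolding U_def by linarith
  show ?case
  proof (cases "w = 1")
    \<comment> \<open>No mass is left for the remainder, which cannot be rescaled; \<open>z\<close>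
      then has the constant value \<open>1 / L\<close> on \<open>A\<close>.\<close>
    case True
    then have "(\<Sum>k\<in>U. \<mu> k * (z k - t)) = 0"
      using split rest0 total unfolding U_def by linarith
    then have "\<mu> k * (z k - t) = 0" if "k \<in> U" for k
      using that tA \<mu>(1) finU by (subst (asm) sum_nonneg_eq_0_iff) (auto simp: less_imp_le)
    then have "z k = t" if "k \<in> A" for k
      using that \<mu>(1)[of k] by (force simp: U_def)
    moreover have "t = 1 / L" using True Lpos by (simp add: w_def field_simps)
    ultimately have "z k = 1 / L" if "k \<in> A" for k using that by simp
    then show ?thesis using flat by simp
  next
    case False
    then have w1': "0 < 1 - w" using w1 by simp
    \<comment> \<open>Division by \<open>1 - w\<close> brings the mass bound of the remainder back
      to 1, and subtracting the same \<open>t\<close> everywhere on \<open>U\<close> keeps the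
      domination by \<open>\<gamma>\<close>.\<close>
    define z' where "z' k = (if k \<in> U then (z k - t) / (1 - w) else 0)" for k
    have IH: "(\<Sum>k\<in>A - {a}. N (c * z' k)) \<le> 1"
    proof (rule Suc.hyps(1))
      show "m = card (A - {a})" using Suc.hyps(2) a(1) by simp
      show "finite (A - {a})" "(A - {a}) \<inter> \<gamma> = {}" using finA disj by auto
      show "0 \<le> z' k" for k using tA w1' by (simp add: z'_def)
      show "z' k \<le> z' i" if "i \<in> \<gamma>" "k \<in> A - {a}" for i k
        using that dom[of i k] w1' by (auto simp: z'_def U_def divide_right_mono)
      have "(\<Sum>k\<in>(A - {a}) \<union> \<gamma>. \<mu> k * z' k) \<le> (\<Sum>k\<in>U. \<mu> k * z' k)"
        using finU tA w1' \<mu>(1)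
        by (intro sum_mono2) (auto simp: z'_def U_def less_imp_le)
      also have "\<dots> = (\<Sum>k\<in>U. \<mu> k * (z k - t)) / (1 - w)"
        unfolding sum_divide_distrib by (intro sum.cong) (simp_all add: z'_def)
      also have "\<dots> \<le> 1"
        using split total w1' unfolding U_def by simp
      finally show "(\<Sum>k\<in>(A - {a}) \<union> \<gamma>. \<mu> k * z' k) \<le> 1" .
    qed
    have "z' a = 0" by (simp add: z'_def t_def)
    then have IH': "(\<Sum>k\<in>A. N (c * z' k)) \<le> 1"
      using IH finA a(1) N(3) by (simp add: sum.remove)
    \<comment> \<open>On \<open>A\<close>, \<open>z k\<close> is the convex combination
      \<open>w * (1 / L) + (1 - w) * z' k\<close>.\<close>
    have "N (c * z k) \<le> w * N (c / L) + (1 - w) * N (c * z' k)" if "k \<in> A" for k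
    proof -
      have "c * z k = c * t + c * (z k - t)" by (simp add: algebra_simps)
      also have "c * (z k - t) = (1 - w) * (c * z' k)"
        using that w1' by (simp add: z'_def U_def)
      also have "c * t = w * (c / L)"
        using Lpos by (simp add: w_def)
      finally have eq: "c * z k = w * (c / L) + (1 - w) * (c * z' k)" .
      have "0 \<le> c * z' k"
        using tA w1' c(1) by (simp add: z'_def)
      then show ?thesis
        unfolding eq
        using convex_onD[OF N(1), of "1 - w" "c / L" "c * z' k"] w0 w1 c(1) Lpos by simp
    qed
    then have "(\<Sum>k\<in>A. N (c * z k)) \<le> (\<Sum>k\<in>A. w * N (c / L) + (1 - w) * N (c * z' k))"
      by (rule sum_mono)
    also have "\<dots> = w * (\<Sum>k\<in>A. N (c / L)) + (1 - w) * (\<Sum>k\<in>A. N (c * z' k))"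
      by (simp only: sum.distrib sum_distrib_left)
    also have "\<dots> \<le> w * 1 + (1 - w) * 1"
      using flat IH' w0 w1' by (intro add_mono mult_left_mono) auto
    finally show ?thesis by simp
  qed
qed

section \<open>Orlicz functions and their inverses\<close>

lemma orlicz_function_ray:
  assumes "orlicz_function M" "0 \<le> a" "a \<le> 1" "0 \<le> t"
  shows "M (a * t) \<le> a * M t"
proof -
  have "M (a * t + (1 - a) * 0) \<le> a * M t + (1 - a) * M 0"
    using assms convex_onD[of "{0..}" M "1 - a" t 0] by (simp add: orlicz_function_def)
  then show ?thesis using assms(1) by (simp add: orlicz_function_def)
qed

text \<open>\<open>M\<close> may vanish near 0, but it is strictly increasing once positive: for
  \<open>u < t\<close>, convexity along the ray from 0 would give
  \<open>M u \<le> u / t * M t \<le> u / t * M u < M u\<close>.\<close>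

lemma orlicz_function_le_imp_le:
  assumes M: "orlicz_function M" and "0 \<le> u" "0 \<le> t" "0 < M u" "M t \<le> M u"
  shows "t \<le> u"
proof (rule ccontr)
  assume "\<not> t \<le> u"
  then have tu: "u < t" by simp
  have "M u = M (u / t * t)" using tu assms by simp
  also have "\<dots> \<le> u / t * M t"
    using tu assms by (intro orlicz_function_ray) auto
  also have "\<dots> \<le> u / t * M u"
    using tu assms by (intro mult_left_mono) auto
  also have "\<dots> < 1 * M u"
    using tu assms by (intro mult_strict_right_mono) auto
  finally show False by simp
qed

lemma orlicz_function_surj:
  assumes M: "orlicz_function M" and "0 < y"
  shows "\<exists>u\<ge>0. M u = y"
proof -
  have conv: "convex_on {0..} M" and nonneg: "\<And>t. 0 \<le> t \<Longrightarrow> 0 \<le> M t" and M0: "M 0 = 0"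
    and lim: "filterlim M at_top at_top"
    using M by (auto simp: orlicz_function_def)
  have "continuous_on {0<..} M"
    using conv by (intro convex_on_continuous) (auto intro: convex_on_subset)
  then have "isCont M t" if "0 < t" for t
    using that by (simp add: continuous_on_eq_continuous_at)
  have "eventually (\<lambda>b. y \<le> M b) at_top"
    using lim by (simp add: filterlim_at_top)
  then have "eventually (\<lambda>b. 0 < b \<and> y \<le> M b) at_top"
    using eventually_gt_at_top by (rule eventually_conj[rotated])
  then obtain b where b: "0 < b" "y \<le> M b"
    by (auto simp: eventually_at_top_linorder)
  \<comment> \<open>Chosen so that the ray inequality gives \<open>M (a * b) \<le> y\<close>. The
    intermediate value theorem then runs on an interval inside the open half-line, where convexity
    yields continuity.\<close>
  define a where "a = y / M b"
  have Mb: "0 < M b" using b \<open>0 < y\<close> by linarith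
  have a: "0 < a" "a \<le> 1" using Mb b \<open>0 < y\<close> by (auto simp: a_def)
  have "M (a * b) \<le> a * M b"
    using M a b by (intro orlicz_function_ray) auto
  then have "M (a * b) \<le> y" using Mb by (simp add: a_def)
  moreover have "a * b \<le> b" using a b by simp
  moreover have "0 < a * b" using a b by simp
  ultimately have "\<exists>u. a * b \<le> u \<and> u \<le> b \<and> M u = y"
    using b(2) \<open>\<And>t. 0 < t \<Longrightarrow> isCont M t\<close> by (intro IVT) auto
  then show ?thesis using \<open>0 < a * b\<close> by (metis less_imp_le order_trans)
qed

lemma orlicz_function_inverse:
  assumes "orlicz_function M" "0 < y"
  shows "M (inv_into {0..} M y) = y" "0 < inv_into {0..} M y"
proof -
  have "y \<in> M ` {0..}"
    using orlicz_function_surj[OF assms] by auto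
  then show *: "M (inv_into {0..} M y) = y"
    by (rule f_inv_into_f)
  have "0 \<le> inv_into {0..} M y"
    using inv_into_into[OF \<open>y \<in> M ` {0..}\<close>] by simp
  moreover have "inv_into {0..} M y \<noteq> 0"
    using * assms by (metis less_irrefl orlicz_function_def)
  ultimately show "0 < inv_into {0..} M y" by simp
qed

section \<open>Upper and lower bounds for best n-term approximation\<close>

lemma sum_mult_unit_seq:
  assumes "finite \<gamma>"
  shows "(\<Sum>i\<in>\<gamma>. a i * unit_seq i k) = (if k \<in> \<gamma> then a k else 0)"
  using assms by (simp add: unit_seq_def if_distrib cong: if_cong)

text \<open>Taking the entries of \<open>y\<close> as coefficients erases \<open>y\<close> on
  \<open>\<gamma>\<close>. Each partial sum of what remains is a finite sum off
  \<open>\<gamma>\<close>, so \<open>\<alpha>\<close> is admissible in the Luxemburg norm.\<close>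

lemma best_approx_le:
  assumes M: "\<And>t. 0 \<le> t \<Longrightarrow> 0 \<le> M t" "M 0 = 0" and \<gamma>: "finite \<gamma>" "card \<gamma> = n" and "0 < \<alpha>"
    and bound: "\<And>A. finite A \<Longrightarrow> A \<inter> \<gamma> = {} \<Longrightarrow> (\<Sum>k\<in>A. M (\<bar>y k\<bar> / \<alpha>)) \<le> 1"
  shows "best_approx n M y \<le> ennreal \<alpha>"
proof -
  let ?r = "\<lambda>k. y k - (\<Sum>i\<in>\<gamma>. y i * unit_seq i k)"
  have r: "?r k = (if k \<in> \<gamma> then 0 else y k)" for k
    using \<gamma>(1) by (simp add: sum_mult_unit_seq)
  have "(\<Sum>k. ennreal (M (\<bar>?r k\<bar> / \<alpha>))) \<le> 1"
  proof (rule suminf_le_const)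
    fix m
    have "(\<Sum>k<m. M (\<bar>?r k\<bar> / \<alpha>)) = (\<Sum>k\<in>{..<m} - \<gamma>. M (\<bar>y k\<bar> / \<alpha>))"
      by (rule sum.mono_neutral_cong_right) (auto simp: r M(2))
    also have "\<dots> \<le> 1" by (rule bound) auto
    finally have "ennreal (\<Sum>k<m. M (\<bar>?r k\<bar> / \<alpha>)) \<le> 1"
      using ennreal_leI by fastforce
    then show "(\<Sum>k<m. ennreal (M (\<bar>?r k\<bar> / \<alpha>))) \<le> 1"
      using \<open>0 < \<alpha>\<close> by (subst sum_ennreal) (auto intro!: M(1))
  qed simp
  then have "orlicz_norm M ?r \<le> ennreal \<alpha>"
    unfolding orlicz_norm_def using \<open>0 < \<alpha>\<close> by (intro INF_lower) simp
  then show ?thesis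
    unfolding best_approx_def using \<gamma>
    by (intro INF_lower2[of \<gamma>] INF_lower2[of y]) auto
qed

text \<open>An \<open>n\<close>-term correction leaves at least \<open>s - n\<close> of the first
  \<open>s\<close> entries equal to \<open>h\<close>. Every admissible \<open>\<alpha>\<close> thus
  satisfies \<open>(s - n) * M (h / \<alpha>) \<le> 1\<close>, which the inverse of \<open>M\<close>
  turns into a lower bound for \<open>\<alpha>\<close>.\<close>

lemma best_approx_flat_ge:
  assumes M: "orlicz_function M" and "n < s" "0 < h" and y: "\<And>k. k < s \<Longrightarrow> y k = h"
  shows "ennreal (h / inv_into {0..} M (1 / (real s - real n))) \<le> best_approx n M y"
  unfolding best_approx_def orlicz_norm_def
proof (intro INF_greatest)
  fix \<gamma> :: "nat set" and a :: "nat \<Rightarrow> real" and \<alpha> :: real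
  assume "\<gamma> \<in> {\<gamma>. finite \<gamma> \<and> card \<gamma> = n}"
    and "\<alpha> \<in> {\<alpha>. 0 < \<alpha> \<and> (\<Sum>k. ennreal (M (\<bar>y k - (\<Sum>i\<in>\<gamma>. a i * unit_seq i k)\<bar> / \<alpha>))) \<le> 1}"
  then have \<gamma>: "finite \<gamma>" "card \<gamma> = n" and "0 < \<alpha>"
    and le: "(\<Sum>k. ennreal (M (\<bar>y k - (\<Sum>i\<in>\<gamma>. a i * unit_seq i k)\<bar> / \<alpha>))) \<le> 1"
    by auto
  let ?d = "real s - real n"
  let ?u = "inv_into {0..} M (1 / ?d)"
  have d: "0 < ?d" using \<open>n < s\<close> by simp
  have nonneg: "\<And>t. 0 \<le> t \<Longrightarrow> 0 \<le> M t" using M by (simp add: orlicz_function_def)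
  have u: "M ?u = 1 / ?d" "0 < ?u"
    using orlicz_function_inverse[OF M, of "1 / ?d"] d by auto
  let ?B = "{..<s} - \<gamma>"
  have "s - n \<le> card ?B"
    using diff_card_le_card_Diff[OF \<gamma>(1), of "{..<s}"] \<gamma>(2) by simp
  then have "?d \<le> real (card ?B)" using \<open>n < s\<close> by linarith
  then have "?d * M (h / \<alpha>) \<le> real (card ?B) * M (h / \<alpha>)"
    using \<open>0 < h\<close> \<open>0 < \<alpha>\<close> by (intro mult_right_mono nonneg) auto
  also have "\<dots> = (\<Sum>k\<in>?B. M (\<bar>y k - (\<Sum>i\<in>\<gamma>. a i * unit_seq i k)\<bar> / \<alpha>))"
    using \<open>0 < h\<close> by (simp add: sum_mult_unit_seq[OF \<gamma>(1)] y)
  also have "\<dots> \<le> 1"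
  proof -
    have "ennreal (\<Sum>k\<in>?B. M (\<bar>y k - (\<Sum>i\<in>\<gamma>. a i * unit_seq i k)\<bar> / \<alpha>))
        = (\<Sum>k\<in>?B. ennreal (M (\<bar>y k - (\<Sum>i\<in>\<gamma>. a i * unit_seq i k)\<bar> / \<alpha>)))"
      using \<open>0 < \<alpha>\<close> by (subst sum_ennreal) (auto intro!: nonneg)
    also have "\<dots> \<le> (\<Sum>k. ennreal (M (\<bar>y k - (\<Sum>i\<in>\<gamma>. a i * unit_seq i k)\<bar> / \<alpha>)))"
      by (intro sum_le_suminf) auto
    also note le
    finally show ?thesis by (simp only: ennreal_le_1)
  qed
  finally have "M (h / \<alpha>) \<le> M ?u"
    unfolding u(1) using d by (simp add: pos_le_divide_eq mult.commute)
  then have "h / \<alpha> \<le> ?u"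
  proof (rule orlicz_function_le_imp_le[OF M, rotated 3])
    show "0 < M ?u" unfolding u(1) using d by simp
  qed (use u(2) \<open>0 < h\<close> \<open>0 < \<alpha>\<close> in simp_all)
  then have "h / ?u \<le> \<alpha>"
    using u(2) \<open>0 < \<alpha>\<close> by (simp add: field_simps)
  then show "ennreal (h / ?u) \<le> ennreal \<alpha>" by (rule ennreal_leI)
qed

section \<open>Decay of the quotients and existence of a maximiser\<close>

text \<open>From some \<open>K\<close> on all terms are at least \<open>2 * B\<close>; once
  \<open>s > 2 * K\<close>, these terms make up more than half of the first
  \<open>s\<close>.\<close>

lemma filterlim_mean_at_top:
  fixes \<mu> :: "nat \<Rightarrow> real"
  assumes "\<And>k. 0 \<le> \<mu> k" "filterlim \<mu> at_top sequentially"
  shows "filterlim (\<lambda>s. (\<Sum>k<s. \<mu> k) / real s) at_top sequentially"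
  unfolding filterlim_at_top_gt[where c = 0]
proof (intro allI impI)
  fix B :: real assume "0 < B"
  obtain K where K: "\<And>k. K \<le> k \<Longrightarrow> 2 * B \<le> \<mu> k"
    using assms(2) unfolding filterlim_at_top eventually_sequentially by metis
  have "B \<le> (\<Sum>k<s. \<mu> k) / real s" if "2 * K + 1 \<le> s" for s
  proof -
    have "(\<Sum>k\<in>{K..<s}. 2 * B) \<le> (\<Sum>k\<in>{K..<s}. \<mu> k)"
      using K by (intro sum_mono) auto
    also have "\<dots> \<le> (\<Sum>k<s. \<mu> k)"
      using assms(1) by (intro sum_mono2) auto
    finally have "real (s - K) * (2 * B) \<le> (\<Sum>k<s. \<mu> k)" by simp
    moreover have "real s * B \<le> real (s - K) * (2 * B)"
    proof -
      have "real s \<le> real (s - K) * 2" using that by linarith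
      from mult_right_mono[OF this, of B] show ?thesis using \<open>0 < B\<close> by simp
    qed
    ultimately show ?thesis using that by (simp add: field_simps)
  qed
  then show "\<forall>\<^sub>F s in sequentially. B \<le> (\<Sum>k<s. \<mu> k) / real s"
    unfolding eventually_sequentially by blast
qed

lemma diag_quotient_pos:
  assumes "orlicz_function M" "\<And>k. 0 < lam k" "n < s"
  shows "0 < diag_quotient n p M lam s"
proof -
  have "0 < (\<Sum>k<s. lam k powr (- p))"
    using assms(2,3) by (intro sum_pos) (auto simp: less_imp_neq[symmetric])
  then show ?thesis
    using orlicz_function_inverse(2)[OF assms(1), of "1 / (real s - real n)"] assms(3)
    by (simp add: diag_quotient_def)
qed

text \<open>On the unit interval \<open>M (t powr (1 / p))\<close> lies below its chord \<open>t * M 1\<close>.\<close>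

lemma powr_inverse_ge:
  assumes "0 < p" and N: "orlicz_function (\<lambda>t. M (t powr (1 / p)))"
    and "0 < u" "0 \<le> M 1" "M u \<le> 1"
  shows "M u / (M 1 + 1) \<le> u powr p"
\<comment> \<open>The summand 1 in \<open>M 1 + 1\<close> keeps the denominator positive when
  \<open>M 1 = 0\<close>, and lets \<open>M u \<le> 1\<close> settle the case
  \<open>1 \<le> u\<close>.\<close>
proof (cases "1 \<le> u")
  case True
  have "M u / (M 1 + 1) \<le> 1" using assms by (simp add: field_simps)
  also have "\<dots> \<le> u powr p" using True \<open>0 < p\<close> by (intro ge_one_powr_ge_zero) auto
  finally show ?thesis .
next
  case False
  then have "u powr p \<le> 1" using assms by (intro powr_le1) auto
  then have "M u \<le> u powr p * M 1"
    using orlicz_function_ray[OF N, of "u powr p" 1] assms by (simp add: powr_powr)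
  also have "\<dots> \<le> u powr p * (M 1 + 1)" by (simp add: algebra_simps)
  finally show ?thesis using assms by (simp add: field_simps)
qed

text \<open>Let \<open>L\<close> be the sum and \<open>u\<close> the inverse value in the quotient.
  Its \<open>p\<close>-th power is \<open>1 / (L * u powr p)\<close>, and \<open>u powr p\<close> is
  at least \<open>1 / (s * (M 1 + 1))\<close>. So this power is at most
  \<open>(M 1 + 1) * s / L\<close>, and the averages \<open>L / s\<close> tend to infinity.\<close>

lemma diag_quotient_eventually_less:
  assumes "0 < p" and M: "orlicz_function M"
    and N: "orlicz_function (\<lambda>t. M (t powr (1 / p)))"
    and lam: "\<And>k. 0 < lam k" "lam \<longlonglongrightarrow> 0" and "0 < e"
  shows "eventually (\<lambda>s. diag_quotient n p M lam s < e) sequentially"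
proof -
  have M1: "0 \<le> M 1" using M by (simp add: orlicz_function_def)
  have "filterlim (\<lambda>k. inverse (lam k)) at_top sequentially"
    using lam by (intro filterlim_inverse_at_top) auto
  then have "filterlim (\<lambda>k. inverse (lam k) powr p) at_top sequentially"
    by (rule filterlim_compose[OF real_powr_at_top[OF \<open>0 < p\<close>]])
  then have "filterlim (\<lambda>k. lam k powr (- p)) at_top sequentially"
    using lam(1) by (simp add: powr_minus inverse_powr less_imp_le)
  then have "filterlim (\<lambda>s. (\<Sum>k<s. lam k powr (- p)) / real s) at_top sequentially"
    by (intro filterlim_mean_at_top) auto
  then have "eventually (\<lambda>s. (M 1 + 1) / e powr p < (\<Sum>k<s. lam k powr (- p)) / real s) sequentially"
    by (simp add: filterlim_at_top_dense)
  then show ?thesis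
    using eventually_gt_at_top[of n]
  proof eventually_elim
    case (elim s)
    let ?L = "\<Sum>k<s. lam k powr (- p)"
    let ?u = "inv_into {0..} M (1 / (real s - real n))"
    have d: "0 < real s - real n" "1 \<le> real s - real n" "0 < real s" using elim(2) by auto
    have u: "M ?u = 1 / (real s - real n)" "0 < ?u"
      using orlicz_function_inverse[OF M, of "1 / (real s - real n)"] d by auto
    have L: "0 < ?L"
      using lam(1) elim(2) by (intro sum_pos) (auto simp: less_imp_neq[symmetric])
    have "1 / real s / (M 1 + 1) \<le> 1 / (real s - real n) / (M 1 + 1)"
      using d M1 by (intro divide_right_mono divide_left_mono) auto
    also have "\<dots> \<le> ?u powr p"
      using powr_inverse_ge[OF \<open>0 < p\<close> N u(2) M1] d u(1) by simp
    finally have up: "1 / real s / (M 1 + 1) \<le> ?u powr p" .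
    define D where "D = real s * (M 1 + 1)"
    have D: "0 < D" using d M1 by (simp add: D_def)
    have "D < e powr p * ?L"
      using elim(1) d \<open>0 < e\<close> by (simp add: D_def field_simps)
    then have "1 / ?L < e powr p / D"
      using L D by (simp add: field_simps)
    then have "1 / ?L < e powr p * (1 / real s / (M 1 + 1))"
      by (simp add: D_def)
    also have "\<dots> \<le> e powr p * ?u powr p"
      using up by (intro mult_left_mono) auto
    also have "\<dots> = (e * ?u) powr p"
      using \<open>0 < e\<close> u(2) by (simp add: powr_mult)
    finally have "(1 / ?L) powr (1 / p) < ((e * ?u) powr p) powr (1 / p)"
      using L \<open>0 < p\<close> by (intro powr_less_mono2) auto
    then have "?L powr (- (1 / p)) < e * ?u"
      using \<open>0 < p\<close> \<open>0 < e\<close> u(2) L by (simp add: powr_powr powr_minus powr_divide inverse_eq_divide)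
    then show ?case
      using u(2) by (simp add: diag_quotient_def field_simps)
  qed
qed

lemma diag_quotient_attains_max:
  assumes "0 < p" "orlicz_function M" "orlicz_function (\<lambda>t. M (t powr (1 / p)))"
    and "\<And>k. 0 < lam k" "lam \<longlonglongrightarrow> 0"
  obtains s where "n < s" "\<And>r. n < r \<Longrightarrow> diag_quotient n p M lam r \<le> diag_quotient n p M lam s"
proof -
  let ?q = "diag_quotient n p M lam"
  have "eventually (\<lambda>s. ?q s < ?q (Suc n)) sequentially"
    using assms by (intro diag_quotient_eventually_less diag_quotient_pos) auto
  then obtain K where K: "\<And>s. K \<le> s \<Longrightarrow> ?q s < ?q (Suc n)"
    unfolding eventually_sequentially by blast
  \<comment> \<open>An index \<open>r > n\<close> outside this window exceeds \<open>K\<close>, so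
    its quotient is below the one at \<open>Suc n\<close>, which the window contains.\<close>
  let ?S = "{Suc n..Suc n + K}"
  have "Max (?q ` ?S) \<in> ?q ` ?S" by (intro Max_in) auto
  then obtain s where s: "s \<in> ?S" "?q s = Max (?q ` ?S)" by (metis imageE)
  have le: "?q r \<le> ?q s" if "r \<in> ?S" for r using that s by simp
  have "?q r \<le> ?q s" if "n < r" for r
  proof (cases "r \<in> ?S")
    case False
    then have "?q r < ?q (Suc n)" using that by (intro K) auto
    also have "\<dots> \<le> ?q s" by (rule le) simp
    finally show ?thesis by simp
  qed (rule le)
  then show thesis using s(1) by (intro that[of s]) auto
qed

section \<open>Upper bound on the unit ball\<close>

text \<open>The indices of the \<open>n\<close> largest entries of the image are removed; the
  peeling bound then shows that \<open>C\<close> is admissible for the rest.\<close>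

lemma best_approx_diag_le:
  assumes "0 < p" and M: "orlicz_function M"
    and N: "orlicz_function (\<lambda>t. M (t powr (1 / p)))"
    and lam: "\<And>k. 0 < lam k" "decseq lam"
    and "0 < C" and C: "\<And>s. n < s \<Longrightarrow> diag_quotient n p M lam s \<le> C"
    and x: "x \<in> lp_ball p"
  shows "best_approx n M (diag_op lam x) \<le> ennreal C"
proof -
  define \<mu> where "\<mu> k = lam k powr (- p)" for k
  define z where "z k = \<bar>lam k * x k\<bar> powr p" for k
  have M0: "\<And>t. 0 \<le> t \<Longrightarrow> 0 \<le> M t" "M 0 = 0" "mono_on {0..} M"
    using M by (auto simp: orlicz_function_def)
  have \<mu>z: "\<mu> k * z k = \<bar>x k\<bar> powr p" for k
    using lam(1)[of k] by (simp add: \<mu>_def z_def abs_mult powr_mult powr_minus)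
  have sm: "summable (\<lambda>k. \<bar>x k\<bar> powr p)" and "(\<Sum>k. \<bar>x k\<bar> powr p) powr (1 / p) \<le> 1"
    using x by (auto simp: lp_ball_def lp_space_def lp_norm_def)
  then have "(\<Sum>k. \<bar>x k\<bar> powr p) \<le> 1"
    using gr_one_powr[of "\<Sum>k. \<bar>x k\<bar> powr p" "1 / p"] \<open>0 < p\<close> by fastforce
  then have fin: "(\<Sum>k\<in>A. \<mu> k * z k) \<le> 1" if "finite A" for A
    using sum_le_suminf[OF sm that] unfolding \<mu>z by simp
  have "(\<lambda>k. \<bar>x k\<bar> powr p) \<longlonglongrightarrow> 0" by (rule summable_LIMSEQ_zero[OF sm])
  then have "(\<lambda>k. lam 0 powr p * \<bar>x k\<bar> powr p) \<longlonglongrightarrow> 0"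
    by (rule tendsto_mult_right_zero)
  then have "z \<longlonglongrightarrow> 0"
  proof (rule tendsto_0_le[where K = 1], intro always_eventually allI)
    fix k
    have "lam k powr p \<le> lam 0 powr p"
      using lam \<open>0 < p\<close> by (intro powr_mono2) (auto simp: less_imp_le decseqD)
    then show "norm (z k) \<le> norm (lam 0 powr p * \<bar>x k\<bar> powr p) * 1"
      using lam(1)[of k] by (simp add: z_def abs_mult powr_mult mult_right_mono)
  qed
  moreover have z0: "\<And>k. 0 \<le> z k" by (simp add: z_def)
  ultimately obtain \<gamma> where \<gamma>: "finite \<gamma>" "card \<gamma> = n"
    "\<And>i k. i \<in> \<gamma> \<Longrightarrow> k \<notin> \<gamma> \<Longrightarrow> z k \<le> z i"
    using exists_largest_entries by metis
  \<comment> \<open>With this scaling \<open>(c * z k) powr (1 / p)\<close> equals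
    \<open>\<bar>diag_op lam x k\<bar> / C\<close>.\<close>
  define c where "c = C powr (- p)"
  have c: "0 \<le> c" "c powr (1 / p) = 1 / C"
    using \<open>0 < C\<close> \<open>0 < p\<close> by (simp_all add: c_def powr_powr powr_neg_one)
  show ?thesis
  proof (rule best_approx_le[where M = M, OF M0(1,2) \<gamma>(1,2) \<open>0 < C\<close>])
    fix A :: "nat set" assume A: "finite A" "A \<inter> \<gamma> = {}"
    have "(\<Sum>k\<in>A. M ((c * z k) powr (1 / p))) \<le> 1"
    proof (rule peeling_bound[where \<mu> = \<mu> and \<gamma> = \<gamma>])
      show "convex_on {0..} (\<lambda>t. M (t powr (1 / p)))" "mono_on {0..} (\<lambda>t. M (t powr (1 / p)))"
        "M (0 powr (1 / p)) = 0"
        using N by (simp_all add: orlicz_function_def)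
      show "0 < \<mu> k" for k using lam(1)[of k] by (simp add: \<mu>_def)
      show "mono \<mu>"
        using lam \<open>0 < p\<close> by (intro monoI) (auto simp: \<mu>_def decseqD intro!: powr_mono2')
      show "0 \<le> c" by (rule c)
      \<comment> \<open>The bound of the quotient by \<open>C\<close> in another form: it says
        \<open>(c / ?L) powr (1 / p) \<le> ?u\<close>, and \<open>M ?u\<close> is
        \<open>1 / (s - n)\<close>.\<close>
      show "(real s - real (card \<gamma>)) * M ((c / (\<Sum>k<s. \<mu> k)) powr (1 / p)) \<le> 1"
        if "card \<gamma> < s" for s
      proof -
        let ?L = "\<Sum>k<s. \<mu> k"
        let ?u = "inv_into {0..} M (1 / (real s - real n))"
        have d: "0 < real s - real n" using that \<gamma>(2) by simp
        have u: "M ?u = 1 / (real s - real n)" "0 < ?u"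
          using orlicz_function_inverse[OF M, of "1 / (real s - real n)"] d by auto
        have L: "0 < ?L"
          using that lam(1) by (intro sum_pos) (auto simp: \<mu>_def less_imp_neq[symmetric])
        have "(c / ?L) powr (1 / p) = ?L powr (- (1 / p)) / C"
          unfolding powr_divide c(2) powr_minus
          by (simp add: field_simps)
        also have "\<dots> \<le> ?u"
          using C[of s] that \<gamma>(2) u(2) \<open>0 < C\<close>
          by (simp add: diag_quotient_def \<mu>_def field_simps)
        finally have "M ((c / ?L) powr (1 / p)) \<le> M ?u"
          using u(2) by (intro mono_onD[OF M0(3)]) auto
        then show ?thesis using u(1) d \<gamma>(2) by (simp add: field_simps)
      qed
      show "(\<Sum>k\<in>A \<union> \<gamma>. \<mu> k * z k) \<le> 1" using A \<gamma> by (intro fin) simp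
      show "z k \<le> z i" if "i \<in> \<gamma>" "k \<in> A" for i k
        using that A \<gamma>(3) by blast
    qed (use A \<gamma> z0 in auto)
    moreover have "(c * z k) powr (1 / p) = \<bar>diag_op lam x k\<bar> / C" for k
      using c \<open>0 < p\<close> by (simp add: z_def diag_op_def powr_mult powr_powr)
    ultimately show "(\<Sum>k\<in>A. M (\<bar>diag_op lam x k\<bar> / C)) \<le> 1" by simp
  qed
qed

section \<open>Extremal sequences\<close>

text \<open>The \<open>p\<close>-th power of entry \<open>k < s\<close> is
  \<open>lam k powr (- p)\<close> divided by the sum of these weights, so the norm is exactly 1.
  Multiplication by \<open>lam k\<close> cancels the dependence on \<open>k\<close> and leaves a
  constant on the initial segment.\<close>

lemma
  assumes "0 < p" and lam: "\<And>k. 0 < lam k" and "0 < s"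
  shows extremal_seq_in_lp_ball: "extremal_seq p lam s \<in> lp_ball p"
    and diag_op_extremal_seq:
      "k < s \<Longrightarrow> diag_op lam (extremal_seq p lam s) k = (\<Sum>j<s. lam j powr (- p)) powr (- (1 / p))"
proof -
  let ?L = "\<Sum>j<s. lam j powr (- p)"
  have L: "0 < ?L"
    using lam \<open>0 < s\<close> by (intro sum_pos) (auto simp: less_imp_neq[symmetric])
  have "((lam k powr p * ?L) powr (- (1 / p))) powr p = lam k powr (- p) / ?L" for k
  proof -
    have "((lam k powr p * ?L) powr (- (1 / p))) powr p = inverse (lam k powr p * ?L)"
      using L \<open>0 < p\<close> by (simp add: powr_powr powr_neg_one inverse_eq_divide)
    then show ?thesis by (simp add: powr_minus[of "lam k"] divide_inverse)
  qed
  then have "\<bar>extremal_seq p lam s k\<bar> powr p = (if k \<in> {..<s} then lam k powr (- p) / ?L else 0)" for k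
    by (simp add: extremal_seq_def)
  then have "(\<lambda>k. \<bar>extremal_seq p lam s k\<bar> powr p) sums (\<Sum>k<s. lam k powr (- p) / ?L)"
    using sums_If_finite_set[of "{..<s}" "\<lambda>k. lam k powr (- p) / ?L"] by simp
  also have "(\<Sum>k<s. lam k powr (- p) / ?L) = 1"
    using L by (simp flip: sum_divide_distrib)
  finally show "extremal_seq p lam s \<in> lp_ball p"
    by (auto simp: lp_ball_def lp_space_def lp_norm_def sums_iff)
  show "diag_op lam (extremal_seq p lam s) k = ?L powr (- (1 / p))" if "k < s"
    using that lam[of k] \<open>0 < p\<close> L
    by (simp add: diag_op_def extremal_seq_def powr_powr powr_mult powr_minus)
qed

lemma best_approx_extremal_seq_ge:
  assumes "0 < p" "orlicz_function M" "\<And>k. 0 < lam k" "n < s"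
  shows "ennreal (diag_quotient n p M lam s) \<le> best_approx n M (diag_op lam (extremal_seq p lam s))"
  unfolding diag_quotient_def
proof (rule best_approx_flat_ge[OF assms(2,4)])
  have "0 < (\<Sum>j<s. lam j powr (- p))"
    using assms by (intro sum_pos) (auto simp: less_imp_neq[symmetric])
  then show "0 < (\<Sum>j<s. lam j powr (- p)) powr (- (1 / p))" by simp
qed (rule diag_op_extremal_seq; use assms in simp)

theorem theorem3:
  fixes p :: real and M :: "real \<Rightarrow> real" and lam :: "nat \<Rightarrow> real" and n :: nat
  assumes "0 < p"
    and "orlicz_function M"
    and "orlicz_function (\<lambda>t. M (t powr (1 / p)))"
    and "\<And>k. 0 < lam k"
    and "decseq lam"
    and "lam \<longlonglongrightarrow> 0"
  shows "best_approx_op n p M (diag_op lam) = (SUP s\<in>{n<..}. ennreal (diag_quotient n p M lam s))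
    \<and> (\<exists>s>n. ennreal (diag_quotient n p M lam s) = (SUP s\<in>{n<..}. ennreal (diag_quotient n p M lam s)))
    \<and> (\<forall>s>n. ennreal (diag_quotient n p M lam s) = (SUP s\<in>{n<..}. ennreal (diag_quotient n p M lam s))
         \<longrightarrow> extremal_seq p lam s \<in> lp_ball p
           \<and> best_approx n M (diag_op lam (extremal_seq p lam s)) = best_approx_op n p M (diag_op lam))"
proof -
  let ?q = "diag_quotient n p M lam"
  let ?S = "SUP s\<in>{n<..}. ennreal (?q s)"
  let ?x = "extremal_seq p lam"
  obtain s0 where s0: "n < s0" "\<And>r. n < r \<Longrightarrow> ?q r \<le> ?q s0"
    by (rule diag_quotient_attains_max[OF assms(1-4,6)]) blast
  \<comment> \<open>The supremum is thereby a finite positive real, so it can serve as the constant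
    \<open>C\<close> of the upper bound.\<close>
  have S: "?S = ennreal (?q s0)"
    using s0 by (intro antisym SUP_least SUP_upper) (auto intro: ennreal_leI)
  have upper: "best_approx n M (diag_op lam x) \<le> ?S" if "x \<in> lp_ball p" for x
    unfolding S using assms s0 that by (intro best_approx_diag_le diag_quotient_pos) auto
  have ball: "?x s \<in> lp_ball p" if "n < s" for s
    using assms that by (intro extremal_seq_in_lp_ball) auto
  have lower: "ennreal (?q s) \<le> best_approx n M (diag_op lam (?x s))" if "n < s" for s
    using assms that by (intro best_approx_extremal_seq_ge) auto
  have op: "best_approx_op n p M (diag_op lam) = ?S"
    unfolding best_approx_op_def
  proof (rule antisym)
    show "?S \<le> (SUP x\<in>lp_ball p. best_approx n M (diag_op lam x))"
      unfolding S using lower[OF s0(1)] ball[OF s0(1)] by (rule SUP_upper2[rotated])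
  qed (intro SUP_least upper)
  \<comment> \<open>The squeeze between the two bounds works for every maximiser \<open>s\<close>,
    not only for \<open>s0\<close>.\<close>
  have "best_approx n M (diag_op lam (?x s)) = ?S" if "n < s" "ennreal (?q s) = ?S" for s
    using upper[OF ball[OF that(1)]] lower[OF that(1)] that(2) by simp
  with s0(1) S ball show ?thesis
    unfolding op by (intro conjI exI[of _ s0] allI impI) simp_all
qed

end
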